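(* Let $\sigma_X>0$, $a_Y>0$ and $\theta_Y>0$. Let $X$ be a log-normally distributed random variable with parameters $\mu_X=0$ and $\sigma_X$, let $Y$ be a Pareto distributed random variable with parameters $a_Y$ and $\theta_Y$, and assume that $X$ and $Y$ are independent. Then the random variable $Z=XY$ has the probability density function $$\begin{aligned} f_Z(z)={}&\frac{\theta_Y}{\sigma_Xz}\,\phi\left(\frac{\log(z/\theta_Y)}{\sigma_X}\right)\\ &+\frac{a_Y\theta_Y^{a_Y}\exp\left\{\frac{a_Y^2\sigma_X^2}{2}\right\}}{z^{a_Y+1}}\,\Phi\left(\frac{\log(z/\theta_Y)-a_Y\sigma_X^2}{\sigma_X}\right)\\ &-\frac{\theta_Y^{a_Y+1}\exp\left\{\frac{a_Y^2\sigma_X^2}{2}\right\}}{\sigma_Xz^{a_Y+1}}\,\phi\left(\frac{\log(z/\theta_Y)-a_Y\sigma_X^2}{\sigma_X}\right),\qquad z>0,\end{aligned}$$ where $\phi$ and $\Phi$ are the probability density function and the cumulative distribution function of the standard Gaussian distribution, respectively.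
   Context: A random variable $X$ is log-normally distributed with parameters $\mu_X\in\mathbb{R}$ and $\sigma_X>0$ if $X=\exp\{N\}$, where $N$ is Gaussian with mean $\mu_X$ and standard deviation $\sigma_X$. A real random variable has the Pareto distribution with parameters $a,\theta>0$ if it has the probability density function (with respect to Lebesgue measure) $f(y)=a\theta^{a}/y^{a+1}$ for $y>\theta$, and $f(y)=0$ otherwise. A density whose formula is given only on an indicated range is zero outside that range. $\log$ is the natural logarithm. *)

theory Defs
  imports "HOL-Probability.Probability"
begin

(* The library predicate distributed takes an ennreal-valued density, and ennreal sends negative
   reals to 0. Nonnegativity of f is therefore required separately, so that the real function f
   itself, and not only its positive part, is a density. *)
definition has_pdf :: "'a measure \<Rightarrow> ('a \<Rightarrow> real) \<Rightarrow> (real \<Rightarrow> real) \<Rightarrow> bool" where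
  "has_pdf M X f \<longleftrightarrow> (\<forall>x. 0 \<le> f x) \<and> distributed M lborel X (\<lambda>x. ennreal (f x))"

(* The equality X = exp N of random variables is understood almost surely. The second argument of
   normal_density is the standard deviation. *)
definition log_normal :: "'a measure \<Rightarrow> ('a \<Rightarrow> real) \<Rightarrow> real \<Rightarrow> real \<Rightarrow> bool" where
  "log_normal M X \<mu> \<sigma> \<longleftrightarrow>
     X \<in> borel_measurable M \<and>
     (\<exists>N. has_pdf M N (normal_density \<mu> \<sigma>) \<and> (AE \<omega> in M. X \<omega> = exp (N \<omega>)))"

definition pareto_density :: "real \<Rightarrow> real \<Rightarrow> real \<Rightarrow> real" where
  "pareto_density a \<theta> y = (if y > \<theta> then a * \<theta> powr a / y powr (a + 1) else 0)"

definition pareto :: "'a measure \<Rightarrow> ('a \<Rightarrow> real) \<Rightarrow> real \<Rightarrow> real \<Rightarrow> bool" where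
  "pareto M Y a \<theta> \<longleftrightarrow> has_pdf M Y (pareto_density a \<theta>)"

abbreviation std_normal_cdf :: "real \<Rightarrow> real" where
  "std_normal_cdf \<equiv> cdf std_normal_distribution"

end

theory Submission
  imports Defs
begin

text \<open>
  Conditioning on \<^term>\<open>X = exp n\<close> and substituting \<^term>\<open>y = exp (-n) * z\<close> gives the
  density of the product as the integral over \<^term>\<open>n\<close> of the Gaussian density against
  \<^term>\<open>exp (-n) * f (exp (-n) * z)\<close>, where \<^term>\<open>f\<close> is the density of \<^term>\<open>Y\<close>.
  For a Pareto density this weight is a multiple of \<^term>\<open>exp (a * n)\<close> on a half-line, and
  completing the square turns the integral into a Gaussian distribution function. This is the
  second term of the formula; the first and the third term cancel.
\<close>

text \<open>Integrating over the exponent \<open>n\<close> keeps the density \<open>g\<close> of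
  \<open>N\<close> itself in the formula, so no density of \<open>X\<close> has to be computed. Both
  densities are \<open>ennreal\<close>-valued and arbitrary, hence no integrability questions
  arise.\<close>

lemma distributed_exp_mult:
  fixes X N Y :: "'a \<Rightarrow> real"
  assumes "prob_space M"
    and N: "distributed M lborel N g"
    and X: "X \<in> borel_measurable M" and XN: "AE \<omega> in M. X \<omega> = exp (N \<omega>)"
    and Y: "distributed M lborel Y f"
    and indep: "prob_space.indep_var M borel X borel Y"
  shows "distributed M lborel (\<lambda>\<omega>. X \<omega> * Y \<omega>)
    (\<lambda>z. \<integral>\<^sup>+n. g n * (ennreal (exp (-n)) * f (exp (-n) * z)) \<partial>lborel)"
proof -
  interpret prob_space M by fact
  have [measurable]: "N \<in> borel_measurable M" "Y \<in> borel_measurable M" "X \<in> borel_measurable M"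
    using N Y X by (auto simp: distributed_def)
  have [measurable]: "g \<in> borel_measurable borel" "f \<in> borel_measurable borel"
    using N Y by (auto simp: distributed_def)
  \<comment> \<open>Independence is assumed of \<open>X\<close> and \<open>Y\<close>, not of
    \<open>N\<close> and \<open>Y\<close>, so \<open>X\<close> is replaced by \<open>exp N\<close>
    only at the level of laws. For this, almost sure equality suffices.\<close>
  have dX: "distr M borel X = distr (density lborel g) borel exp"
  proof -
    have "distr M borel X = distr M borel (\<lambda>\<omega>. exp (N \<omega>))"
      using XN by (intro distr_cong_AE) auto
    also have "\<dots> = distr (distr M lborel N) borel exp"
      by (subst distr_distr) (auto simp: comp_def)
    also have "distr M lborel N = density lborel g"
      using N by (simp add: distributed_def)
    finally show ?thesis .
  qed
  have dY: "distr M borel Y = density lborel f"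
  proof -
    have "distr M borel Y = distr M lborel Y" by (rule distr_cong) auto
    then show ?thesis using Y by (simp add: distributed_def)
  qed
  have dXY: "distr M (borel \<Otimes>\<^sub>M borel) (\<lambda>\<omega>. (X \<omega>, Y \<omega>)) = distr M borel X \<Otimes>\<^sub>M distr M borel Y"
    using indep by (simp only: indep_var_distribution_eq)
  \<comment> \<open>A probability measure is sigma-finite, as required for splitting the integral
    over the product law into iterated integrals.\<close>
  interpret PY: prob_space "distr M borel Y" by (rule prob_space_distr) simp
  have "distr M lborel (\<lambda>\<omega>. X \<omega> * Y \<omega>) =
    density lborel (\<lambda>z. \<integral>\<^sup>+n. g n * (ennreal (exp (-n)) * f (exp (-n) * z)) \<partial>lborel)"
    (is "?l = density lborel ?h")
  proof (rule measure_eqI)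
    fix A assume "A \<in> sets ?l"
    then have [measurable]: "A \<in> sets borel" by simp
    have "emeasure ?l A = (\<integral>\<^sup>+\<omega>. indicator A (X \<omega> * Y \<omega>) \<partial>M)"
      by (simp add: nn_integral_distr del: nn_integral_indicator flip: nn_integral_indicator)
    also have "\<dots> = (\<integral>\<^sup>+p. indicator A (fst p * snd p) \<partial>distr M (borel \<Otimes>\<^sub>M borel) (\<lambda>\<omega>. (X \<omega>, Y \<omega>)))"
      by (simp add: nn_integral_distr)
    also have "\<dots> = (\<integral>\<^sup>+x. \<integral>\<^sup>+y. indicator A (x * y) \<partial>distr M borel Y \<partial>distr M borel X)"
      unfolding dXY by (subst PY.nn_integral_fst[symmetric]) auto
    also have "\<dots> = (\<integral>\<^sup>+x. \<integral>\<^sup>+y. f y * indicator A (x * y) \<partial>lborel \<partial>distr M borel X)"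
      unfolding dY by (simp add: nn_integral_density)
    also have "\<dots> = (\<integral>\<^sup>+n. g n * (\<integral>\<^sup>+y. f y * indicator A (exp n * y) \<partial>lborel) \<partial>lborel)"
      unfolding dX by (simp add: nn_integral_density nn_integral_distr)
    also have "\<dots> = (\<integral>\<^sup>+n. g n * (\<integral>\<^sup>+z. ennreal (exp (-n)) * f (exp (-n) * z) * indicator A z \<partial>lborel) \<partial>lborel)"
    proof (rule nn_integral_cong)
      fix n :: real
      have e: "exp n * (exp (-n) * z) = z" for z :: real
        by (simp add: exp_minus)
      \<comment> \<open>The substitution is \<open>y = exp (-n) * z\<close>; its Jacobian
        \<open>exp (-n)\<close> is positive, so the absolute value disappears.\<close>
      have "(\<integral>\<^sup>+y. f y * indicator A (exp n * y) \<partial>lborel) =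
          (\<integral>\<^sup>+z. ennreal (exp (-n)) * f (exp (-n) * z) * indicator A z \<partial>lborel)"
        by (subst nn_integral_real_affine[where c="exp (-n)" and t=0])
           (simp_all add: e nn_integral_cmult mult.assoc)
      then show "g n * (\<integral>\<^sup>+y. f y * indicator A (exp n * y) \<partial>lborel) =
          g n * (\<integral>\<^sup>+z. ennreal (exp (-n)) * f (exp (-n) * z) * indicator A z \<partial>lborel)"
        by simp
    qed
    also have "\<dots> = (\<integral>\<^sup>+n. \<integral>\<^sup>+z. g n * (ennreal (exp (-n)) * f (exp (-n) * z)) * indicator A z \<partial>lborel \<partial>lborel)"
      by (simp add: nn_integral_cmult[symmetric] mult.assoc)
    \<comment> \<open>Tonelli for a nonnegative integrand. The indicator of \<open>A\<close> does
      not depend on \<open>n\<close> and can then leave the inner integral.\<close>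
    also have "\<dots> = (\<integral>\<^sup>+z. \<integral>\<^sup>+n. g n * (ennreal (exp (-n)) * f (exp (-n) * z)) * indicator A z \<partial>lborel \<partial>lborel)"
      by (rule lborel_pair.Fubini') simp
    also have "\<dots> = (\<integral>\<^sup>+z. ?h z * indicator A z \<partial>lborel)"
      by (simp add: nn_integral_multc)
    also have "\<dots> = emeasure (density lborel ?h) A"
      by (simp add: emeasure_density)
    finally show "emeasure ?l A = emeasure (density lborel ?h) A" .
  qed simp
  then show ?thesis by (simp add: distributed_def)
qed

lemma normal_density_eq_std:
  assumes "\<sigma> > 0"
  shows "normal_density \<mu> \<sigma> x = std_normal_density ((x - \<mu>) / \<sigma>) / \<sigma>"
  using assms by (simp add: normal_density_def real_sqrt_mult power_divide)

text \<open>Standardising by \<open>x = \<mu> + \<sigma> * t\<close> reduces this to the standard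
  Gaussian. The half-line is open because the Pareto density lives on
  \<open>y > \<theta>\<close>.\<close>

lemma nn_integral_normal_density_lessThan:
  assumes "\<sigma> > 0"
  shows "(\<integral>\<^sup>+x. ennreal (normal_density \<mu> \<sigma> x) * indicator {..<b} x \<partial>lborel)
    = ennreal (std_normal_cdf ((b - \<mu>) / \<sigma>))"
proof -
  interpret S: prob_space std_normal_distribution by (rule prob_space_normal_density) simp
  have "(\<integral>\<^sup>+x. ennreal (normal_density \<mu> \<sigma> x) * indicator {..<b} x \<partial>lborel) =
    (\<integral>\<^sup>+x. ennreal \<sigma> * (ennreal (normal_density \<mu> \<sigma> (\<mu> + \<sigma> * x)) * indicator {..<b} (\<mu> + \<sigma> * x)) \<partial>lborel)"
    using assms by (subst nn_integral_real_affine[where c=\<sigma> and t=\<mu>]) (simp_all add: nn_integral_cmult)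
  also have "\<dots> = (\<integral>\<^sup>+x. ennreal (std_normal_density x) * indicator {..(b - \<mu>) / \<sigma>} x \<partial>lborel)"
  \<comment> \<open>The half-line in the integral is open and the one in the distribution function
    is closed; they differ only at the endpoint, a null set.\<close>
  proof (intro nn_integral_cong_AE, use AE_lborel_singleton[of "(b - \<mu>) / \<sigma>"] in eventually_elim)
    fix x assume "x \<noteq> (b - \<mu>) / \<sigma>"
    then show "ennreal \<sigma> * (ennreal (normal_density \<mu> \<sigma> (\<mu> + \<sigma> * x)) * indicator {..<b} (\<mu> + \<sigma> * x)) =
      ennreal (std_normal_density x) * indicator {..(b - \<mu>) / \<sigma>} x"
      using assms
      by (auto simp: normal_density_eq_std[OF assms] ennreal_mult[symmetric] field_simps
          split: split_indicator)
  qed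
  also have "\<dots> = emeasure std_normal_distribution {..(b - \<mu>) / \<sigma>}"
    by (simp add: emeasure_density)
  also have "\<dots> = ennreal (std_normal_cdf ((b - \<mu>) / \<sigma>))"
    by (simp add: cdf_def S.emeasure_eq_measure)
  finally show ?thesis .
qed

text \<open>Completing the square: exponential tilting moves the mean of a centred Gaussian to
  \<open>a * \<sigma>\<^sup>2\<close> and keeps the variance. The constant is its moment generating
  function at \<open>a\<close>.\<close>

lemma normal_density_exp_tilt:
  assumes "\<sigma> > 0"
  shows "normal_density 0 \<sigma> x * exp (a * x) = exp (a\<^sup>2 * \<sigma>\<^sup>2 / 2) * normal_density (a * \<sigma>\<^sup>2) \<sigma> x"
proof -
  have "- x\<^sup>2 / (2 * \<sigma>\<^sup>2) + a * x = a\<^sup>2 * \<sigma>\<^sup>2 / 2 - (x - a * \<sigma>\<^sup>2)\<^sup>2 / (2 * \<sigma>\<^sup>2)"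
    using assms by (simp add: field_simps power2_eq_square)
  then have "exp (- x\<^sup>2 / (2 * \<sigma>\<^sup>2)) * exp (a * x) =
      exp (a\<^sup>2 * \<sigma>\<^sup>2 / 2) * exp (- (x - a * \<sigma>\<^sup>2)\<^sup>2 / (2 * \<sigma>\<^sup>2))"
    by (simp add: exp_add[symmetric])
  then show ?thesis
    by (simp add: normal_density_def)
qed

text \<open>The Jacobian \<open>exp (-n)\<close> cancels the extra 1 in the exponent
  \<open>a + 1\<close>, which leaves \<open>exp (a * n)\<close>; taking logarithms turns the support
  condition into an upper bound on \<open>n\<close>.\<close>

lemma exp_mult_pareto_density:
  assumes "\<theta> > 0" and "z > 0"
  shows "exp (-n) * pareto_density a \<theta> (exp (-n) * z) =
    a * \<theta> powr a / z powr (a + 1) * exp (a * n) * indicator {..<ln (z / \<theta>)} n"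
proof -
  have "\<theta> < exp (-n) * z \<longleftrightarrow> exp n < z / \<theta>"
    using assms by (simp add: exp_minus field_simps)
  also have "\<dots> \<longleftrightarrow> n < ln (z / \<theta>)"
    using assms by (metis divide_pos_pos exp_less_cancel_iff exp_ln)
  finally have iff: "\<theta> < exp (-n) * z \<longleftrightarrow> n < ln (z / \<theta>)" .
  have "(exp (-n) * z) powr (a + 1) = exp (-n) * exp (- (a * n)) * z powr (a + 1)"
    by (simp add: powr_mult exp_powr_real exp_add[symmetric] algebra_simps)
  then show ?thesis
    using iff assms by (auto simp: pareto_density_def exp_minus field_simps split: split_indicator)
qed

lemma nn_integral_normal_pareto:
  assumes "\<sigma> > 0" "a > 0" "\<theta> > 0"
  shows "(\<integral>\<^sup>+n. ennreal (normal_density 0 \<sigma> n) *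
        (ennreal (exp (-n)) * ennreal (pareto_density a \<theta> (exp (-n) * z))) \<partial>lborel) =
    ennreal (if z > 0 then a * \<theta> powr a * exp (a\<^sup>2 * \<sigma>\<^sup>2 / 2) / z powr (a + 1)
      * std_normal_cdf ((ln (z / \<theta>) - a * \<sigma>\<^sup>2) / \<sigma>) else 0)"
proof (cases "z > 0")
  case True
  let ?C = "a * \<theta> powr a * exp (a\<^sup>2 * \<sigma>\<^sup>2 / 2) / z powr (a + 1)"
  have C: "?C \<ge> 0" using assms by simp
  have "ennreal (normal_density 0 \<sigma> n) *
        (ennreal (exp (-n)) * ennreal (pareto_density a \<theta> (exp (-n) * z))) =
      ennreal ?C * (ennreal (normal_density (a * \<sigma>\<^sup>2) \<sigma> n) * indicator {..<ln (z / \<theta>)} n)" for n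
  proof -
    have "normal_density 0 \<sigma> n * (exp (-n) * pareto_density a \<theta> (exp (-n) * z)) =
        a * \<theta> powr a / z powr (a + 1) * (normal_density 0 \<sigma> n * exp (a * n)) * indicator {..<ln (z / \<theta>)} n"
      unfolding exp_mult_pareto_density[OF assms(3) True] by simp
    also have "\<dots> = ?C * (normal_density (a * \<sigma>\<^sup>2) \<sigma> n * indicator {..<ln (z / \<theta>)} n)"
      unfolding normal_density_exp_tilt[OF assms(1)] by simp
    finally show ?thesis
      using C by (simp add: ennreal_mult'[symmetric] ennreal_indicator[symmetric] del: ennreal_indicator)
  qed
  then show ?thesis
    using True
    by (simp add: nn_integral_cmult nn_integral_normal_density_lessThan[OF assms(1)]
        ennreal_mult'[OF C, symmetric])
next
  case False
  \<comment> \<open>For \<open>z \<le> 0\<close> the argument stays below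
    \<open>\<theta> > 0\<close> for every \<open>n\<close>, so the integrand vanishes
    identically.\<close>
  have "pareto_density a \<theta> (exp (-n) * z) = 0" for n
  proof -
    have "exp (-n) * z \<le> 0" using False by (simp add: mult_le_0_iff)
    then show ?thesis using assms by (simp add: pareto_density_def)
  qed
  then show ?thesis using False by simp
qed

text \<open>This is the tilting identity at the point \<open>ln (z / \<theta>)\<close>, where the
  exponential weight equals the power \<open>(z / \<theta>) powr a\<close>. It makes the first and
  third terms of the final formula cancel.\<close>

lemma std_normal_density_shift:
  assumes "\<sigma> > 0" and "\<theta> > 0" and "z > 0"
  shows "\<theta> powr (a + 1) * exp (a\<^sup>2 * \<sigma>\<^sup>2 / 2) / (\<sigma> * z powr (a + 1))
      * std_normal_density ((ln (z / \<theta>) - a * \<sigma>\<^sup>2) / \<sigma>) =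
    \<theta> / (\<sigma> * z) * std_normal_density (ln (z / \<theta>) / \<sigma>)"
proof -
  have e: "exp (a * ln (z / \<theta>)) = z powr a / \<theta> powr a"
    using assms by (simp add: powr_def ln_div exp_diff[symmetric] algebra_simps)
  have "exp (a\<^sup>2 * \<sigma>\<^sup>2 / 2) * std_normal_density ((ln (z / \<theta>) - a * \<sigma>\<^sup>2) / \<sigma>) =
      std_normal_density (ln (z / \<theta>) / \<sigma>) * (z powr a / \<theta> powr a)"
    using normal_density_exp_tilt[OF assms(1), of "ln (z / \<theta>)" a] assms(1)
    unfolding normal_density_eq_std[OF assms(1)] e by (simp add: field_simps)
  then have "\<theta> powr (a + 1) / (\<sigma> * z powr (a + 1)) * (exp (a\<^sup>2 * \<sigma>\<^sup>2 / 2)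
        * std_normal_density ((ln (z / \<theta>) - a * \<sigma>\<^sup>2) / \<sigma>)) =
      \<theta> powr (a + 1) / (\<sigma> * z powr (a + 1)) * (std_normal_density (ln (z / \<theta>) / \<sigma>) * (z powr a / \<theta> powr a))"
    by simp
  also have "\<dots> = \<theta> / (\<sigma> * z) * std_normal_density (ln (z / \<theta>) / \<sigma>)"
    using assms by (simp add: powr_add)
  finally show ?thesis by (simp add: mult.assoc)
qed

theorem lemma3:
  fixes M :: "'a measure" and X Y :: "'a \<Rightarrow> real" and \<sigma>\<^sub>X a\<^sub>Y \<theta>\<^sub>Y :: real
  assumes "prob_space M"
    and "\<sigma>\<^sub>X > 0" and "a\<^sub>Y > 0" and "\<theta>\<^sub>Y > 0"
    and "log_normal M X 0 \<sigma>\<^sub>X"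
    and "pareto M Y a\<^sub>Y \<theta>\<^sub>Y"
    and "prob_space.indep_var M borel X borel Y"
  shows "has_pdf M (\<lambda>\<omega>. X \<omega> * Y \<omega>)
    (\<lambda>z. if z > 0 then
        \<theta>\<^sub>Y / (\<sigma>\<^sub>X * z) * std_normal_density (ln (z / \<theta>\<^sub>Y) / \<sigma>\<^sub>X)
      + a\<^sub>Y * \<theta>\<^sub>Y powr a\<^sub>Y * exp (a\<^sub>Y\<^sup>2 * \<sigma>\<^sub>X\<^sup>2 / 2) / z powr (a\<^sub>Y + 1)
          * std_normal_cdf ((ln (z / \<theta>\<^sub>Y) - a\<^sub>Y * \<sigma>\<^sub>X\<^sup>2) / \<sigma>\<^sub>X)
      - \<theta>\<^sub>Y powr (a\<^sub>Y + 1) * exp (a\<^sub>Y\<^sup>2 * \<sigma>\<^sub>X\<^sup>2 / 2) / (\<sigma>\<^sub>X * z powr (a\<^sub>Y + 1))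
          * std_normal_density ((ln (z / \<theta>\<^sub>Y) - a\<^sub>Y * \<sigma>\<^sub>X\<^sup>2) / \<sigma>\<^sub>X)
      else 0)"
    (is "has_pdf M _ ?f")
proof -
  obtain N where N: "distributed M lborel N (\<lambda>x. ennreal (normal_density 0 \<sigma>\<^sub>X x))"
    and X: "X \<in> borel_measurable M" "AE \<omega> in M. X \<omega> = exp (N \<omega>)"
    using assms(5) by (auto simp: log_normal_def has_pdf_def)
  have Y: "distributed M lborel Y (\<lambda>y. ennreal (pareto_density a\<^sub>Y \<theta>\<^sub>Y y))"
    using assms(6) by (simp add: pareto_def has_pdf_def)
  let ?h = "\<lambda>z. if z > 0 then a\<^sub>Y * \<theta>\<^sub>Y powr a\<^sub>Y * exp (a\<^sub>Y\<^sup>2 * \<sigma>\<^sub>X\<^sup>2 / 2) / z powr (a\<^sub>Y + 1)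
      * std_normal_cdf ((ln (z / \<theta>\<^sub>Y) - a\<^sub>Y * \<sigma>\<^sub>X\<^sup>2) / \<sigma>\<^sub>X) else 0"
  have f: "?f = ?h"
    using std_normal_density_shift[OF assms(2,4)] by (intro ext) auto
  have "distributed M lborel (\<lambda>\<omega>. X \<omega> * Y \<omega>) (\<lambda>z. ennreal (?h z))"
    using distributed_exp_mult[OF assms(1) N X Y assms(7)]
    unfolding nn_integral_normal_pareto[OF assms(2-4)] .
  \<comment> \<open>Nonnegativity is read off from the reduced form; the three-term form hides it
    behind a subtraction.\<close>
  moreover have "?h z \<ge> 0" for z
    using assms(3) by (simp add: cdf_def)
  ultimately show ?thesis
    unfolding has_pdf_def f by blast
qed

end
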